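(* Let $(X,d)$ be a metric space with base point $x_0\in X$, and let $Y\subseteq X$ be a subset containing $x_0$, equipped with the restricted metric and the base point $x_0$. Then for every $h\in\overline{Y}$ there is a metric functional $H\in\overline{X}$ which extends $h$, in the sense that $H|_Y=h$.
   Context: For a metric space $(Z,d)$ with base point $x_0\in Z$ and a point $z\in Z$, define $h_z:Z\to\mathbb{R}$ by $h_z(w)=d(w,z)-d(x_0,z)$. The metric compactification $\overline{Z}$ is the closure of $\{h_z: z\in Z\}$ in $\mathbb{R}^Z$ with the topology of pointwise convergence (product topology). Elements of $\overline{Z}$ are called metric functionals of $Z$. *)

theory Defs
  imports "HOL-Analysis.Analysis"
begin

(* Real-valued functions on a carrier Z are the extensional functions on Z, i.e. the points of
   product_topology (\<lambda>_. euclideanreal) Z. *)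

definition internal_functional :: "'a set \<Rightarrow> ('a \<Rightarrow> 'a \<Rightarrow> real) \<Rightarrow> 'a \<Rightarrow> 'a \<Rightarrow> 'a \<Rightarrow> real"
  where "internal_functional Z d x0 z = (\<lambda>w\<in>Z. d w z - d x0 z)"

definition metric_compactification :: "'a set \<Rightarrow> ('a \<Rightarrow> 'a \<Rightarrow> real) \<Rightarrow> 'a \<Rightarrow> ('a \<Rightarrow> real) set"
  where "metric_compactification Z d x0 =
    product_topology (\<lambda>_. euclideanreal) Z closure_of (internal_functional Z d x0 ` Z)"

end

theory Submission
  imports Defs
begin

text \<open>
  By the triangle inequality every internal functional satisfies
  \<open>\<bar>h\<^sub>z w\<bar> \<le> d x0 w\<close>. Hence the functionals of \<open>X\<close> all lie in a product of compact intervals,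
  and by Tychonoff's theorem the metric compactification of \<open>X\<close> is compact. Restriction of
  functions from \<open>X\<close> to \<open>Y\<close> is continuous, so it maps this compactification onto a compact,
  hence closed, set of functions on \<open>Y\<close>. For \<open>z \<in> Y\<close> the internal functional of \<open>z\<close> on \<open>X\<close>
  restricts to that of \<open>z\<close> on \<open>Y\<close>. The closed image thus contains the internal functionals of
  \<open>Y\<close>, and with them their closure.
\<close>

lemma restrict_internal_functional:
  assumes "Y \<subseteq> X"
  shows "restrict (internal_functional X d x0 z) Y = internal_functional Y d x0 z"
  using assms by (auto simp: internal_functional_def fun_eq_iff)

lemma internal_functional_in_metric_compactification:
  assumes "z \<in> Z"
  shows "internal_functional Z d x0 z \<in> metric_compactification Z d x0"
proof -
  have "internal_functional Z d x0 ` Z \<subseteq> topspace (product_topology (\<lambda>_. euclideanreal) Z)"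
    by (auto simp: internal_functional_def)
  then have "internal_functional Z d x0 ` Z \<subseteq> metric_compactification Z d x0"
    unfolding metric_compactification_def by (rule closure_of_subset)
  then show ?thesis
    using assms by blast
qed

lemma internal_functional_in_box:
  assumes "Metric_space Z d" and "x0 \<in> Z" and "z \<in> Z"
  shows "internal_functional Z d x0 z \<in> (\<Pi>\<^sub>E w\<in>Z. {- d x0 w..d x0 w})"
proof -
  interpret Metric_space Z d by fact
  have "\<bar>d w z - d x0 z\<bar> \<le> d x0 w" if "w \<in> Z" for w
    using triangle[of w x0 z] triangle[of x0 w z] commute[of w x0] that assms by linarith
  then show ?thesis
    by (auto simp: internal_functional_def abs_le_iff) (smt (verit))+
qed

text \<open>
  The box is itself closed, so the closure defining the compactification stays inside it and is
  a closed subset of a compact set.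
\<close>

lemma compactin_metric_compactification:
  assumes "Metric_space Z d" and "x0 \<in> Z"
  shows "compactin (product_topology (\<lambda>_. euclideanreal) Z) (metric_compactification Z d x0)"
proof -
  let ?T = "product_topology (\<lambda>_. euclideanreal) Z"
  let ?B = "\<Pi>\<^sub>E w\<in>Z. {- d x0 w..d x0 w}"
  have box: "compactin ?T ?B"
    by (simp add: compactin_PiE)
  moreover have "closedin ?T ?B"
    by (simp add: closedin_product_topology)
  then have "metric_compactification Z d x0 \<subseteq> ?B"
    unfolding metric_compactification_def
    using internal_functional_in_box[OF assms] by (intro closure_of_minimal) auto
  moreover have "closedin ?T (metric_compactification Z d x0)"
    by (simp add: metric_compactification_def)
  ultimately show ?thesis
    by (rule closed_compactin)
qed

lemma continuous_map_restrict_product: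
  assumes "J \<subseteq> I"
  shows "continuous_map (product_topology T I) (product_topology T J) (\<lambda>f. restrict f J)"
  using assms
  by (auto simp: continuous_map_componentwise intro: continuous_map_product_projection)

theorem proposition7:
  fixes X Y :: "'a set" and d :: "'a \<Rightarrow> 'a \<Rightarrow> real" and x0 :: 'a
  assumes "Metric_space X d"
    and "Y \<subseteq> X"
    and "x0 \<in> Y"
  shows "\<forall>h \<in> metric_compactification Y d x0.
    \<exists>H \<in> metric_compactification X d x0. restrict H Y = h"
proof -
  let ?TX = "product_topology (\<lambda>_. euclideanreal) X"
  let ?TY = "product_topology (\<lambda>_. euclideanreal) Y"
  let ?R = "(\<lambda>H. restrict H Y) ` metric_compactification X d x0"
  have "compactin ?TX (metric_compactification X d x0)"
    using assms by (intro compactin_metric_compactification) auto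
  then have "compactin ?TY ?R"
    by (rule image_compactin) (rule continuous_map_restrict_product[OF assms(2)])
  moreover have "Hausdorff_space ?TY"
    by (simp add: Hausdorff_space_product_topology)
  ultimately have closed: "closedin ?TY ?R"
    by (simp add: compactin_imp_closedin)
  have "internal_functional Y d x0 ` Y \<subseteq> ?R"
  proof
    fix g assume "g \<in> internal_functional Y d x0 ` Y"
    then obtain z where "z \<in> Y" and "g = restrict (internal_functional X d x0 z) Y"
      by (auto simp: restrict_internal_functional[OF assms(2)])
    then show "g \<in> ?R"
      using assms(2) by (blast intro: internal_functional_in_metric_compactification)
  qed
  then have "metric_compactification Y d x0 \<subseteq> ?R"
    unfolding metric_compactification_def[of Y] using closed by (rule closure_of_minimal)
  then show ?thesis
    by blast
qed

end
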